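(* Let $m\ge1$ and, for $\ell=1,\dots,m$, let $\mathbf p_{r_\ell}$ be an $r_\ell\times r_\ell$ matrix-valued trigonometric polynomial in one variable. Let $\mathbf p^{(m)}_{\mathbf r}(\theta_1,\dots,\theta_m)=\bigotimes_{\ell=1}^m\mathbf p_{r_\ell}(\theta_\ell)$ and suppose that $$\sum_{\xi\in\Omega(\boldsymbol\theta)}\mathbf p^{(m)}_{\mathbf r}(\xi)^H\mathbf p^{(m)}_{\mathbf r}(\xi)>0\quad\text{for all }\boldsymbol\theta\in[0,2\pi)^m .$$ Then the function $$\mathbf s(\boldsymbol\theta)=\mathbf p^{(m)}_{\mathbf r}(\boldsymbol\theta)\left(\sum_{\xi\in\Omega(\boldsymbol\theta)}\mathbf p^{(m)}_{\mathbf r}(\xi)^H\mathbf p^{(m)}_{\mathbf r}(\xi)\right)^{-1}\mathbf p^{(m)}_{\mathbf r}(\boldsymbol\theta)^H$$ is well-defined for all $\boldsymbol\theta\in[0,2\pi)^m$. Moreover, $$\mathbf s(\boldsymbol\theta)=\bigotimes_{\ell=1}^m\mathbf s_{r_\ell}(\theta_\ell),$$ where, for $\ell=1,\dots,m$, $$\mathbf s_{r_\ell}(\theta_\ell)=\mathbf p_{r_\ell}(\theta_\ell)\left(\mathbf p_{r_\ell}(\theta_\ell)^H\mathbf p_{r_\ell}(\theta_\ell)+\mathbf p_{r_\ell}(\theta_\ell+\pi)^H\mathbf p_{r_\ell}(\theta_\ell+\pi)\right)^{-1}\mathbf p_{r_\ell}(\theta_\ell)^H .$$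
   Context: $\otimes$ is the Kronecker product, $X^H$ the conjugate transpose, and $X>0$ means $X$ is Hermitian positive definite. For $\boldsymbol\theta=(\theta_1,\dots,\theta_m)$, $\Omega(\boldsymbol\theta)=\{\boldsymbol\theta+\pi\boldsymbol\eta:\ \boldsymbol\eta\in\{0,1\}^m\}$. *)

theory Defs
  imports "Jordan_Normal_Form.Schur_Decomposition"
begin

text \<open>Tuples of length \<open>m\<close> are vectors in \<^term>\<open>carrier_vec m\<close>; the indices \<open>1, \<dots>, m\<close> are
  shifted to \<open>0, \<dots>, m - 1\<close>.\<close>

abbreviation mat_sum :: "nat \<Rightarrow> ('b \<Rightarrow> complex mat) \<Rightarrow> 'b set \<Rightarrow> complex mat" where
  "mat_sum n \<equiv> finsum (module_mat TYPE(complex) n n)"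

definition matrix_trig_poly :: "nat \<Rightarrow> (real \<Rightarrow> complex mat) \<Rightarrow> bool" where
  "matrix_trig_poly r p \<longleftrightarrow>
     (\<exists>(c :: nat) (a :: int \<Rightarrow> complex mat).
        (\<forall>k. a k \<in> carrier_mat r r) \<and>
        (\<forall>\<theta>. p \<theta> = mat_sum r (\<lambda>k. cis (of_int k * \<theta>) \<cdot>\<^sub>m a k) {- int c..int c}))"

definition kronecker :: "complex mat \<Rightarrow> complex mat \<Rightarrow> complex mat" (infixl "\<otimes>\<^sub>K" 70) where
  "A \<otimes>\<^sub>K B = mat (dim_row A * dim_row B) (dim_col A * dim_col B)
     (\<lambda>(i, j). A $$ (i div dim_row B, j div dim_col B) * B $$ (i mod dim_row B, j mod dim_col B))"

text \<open>\<open>kronecker_prod A m\<close> is \<open>A 0 \<otimes>\<^sub>K \<dots> \<otimes>\<^sub>K A (m - 1)\<close>; the \<open>1 \<times> 1\<close> identity is the unit of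
  \<open>\<otimes>\<^sub>K\<close>.\<close>

primrec kronecker_prod :: "(nat \<Rightarrow> complex mat) \<Rightarrow> nat \<Rightarrow> complex mat" where
  "kronecker_prod A 0 = 1\<^sub>m 1"
| "kronecker_prod A (Suc m) = kronecker_prod A m \<otimes>\<^sub>K A m"

text \<open>The order on \<^typ>\<open>complex\<close> is the partial one in which \<open>0 < z\<close> means that \<open>z\<close> is real and
  positive.\<close>

definition hermitian_pos_def :: "complex mat \<Rightarrow> bool" where
  "hermitian_pos_def X \<longleftrightarrow> square_mat X \<and> mat_adjoint X = X \<and>
     (\<forall>v \<in> carrier_vec (dim_row X). v \<noteq> 0\<^sub>v (dim_row X) \<longrightarrow> 0 < (X *\<^sub>v v) \<bullet>c v)"

text \<open>Total version of the inverse, meaningful only where \<^const>\<open>invertible_mat\<close> holds.\<close>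

definition mat_inv :: "complex mat \<Rightarrow> complex mat" where
  "mat_inv X = the (mat_inverse X)"

definition Omega :: "real vec \<Rightarrow> real vec set" where
  "Omega \<theta> = {\<theta> + pi \<cdot>\<^sub>v \<eta> | \<eta>. \<eta> \<in> carrier_vec (dim_vec \<theta>) \<and> (\<forall>l < dim_vec \<theta>. \<eta> $ l \<in> {0, 1})}"

definition theta_box :: "nat \<Rightarrow> real vec set" where
  "theta_box m = {\<theta> \<in> carrier_vec m. \<forall>l < m. \<theta> $ l \<in> {0..<2 * pi}}"

definition p_multi :: "nat \<Rightarrow> (nat \<Rightarrow> real \<Rightarrow> complex mat) \<Rightarrow> real vec \<Rightarrow> complex mat" where
  "p_multi m p \<theta> = kronecker_prod (\<lambda>l. p l (\<theta> $ l)) m"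

definition normal_sum_multi ::
    "nat \<Rightarrow> (nat \<Rightarrow> nat) \<Rightarrow> (nat \<Rightarrow> real \<Rightarrow> complex mat) \<Rightarrow> real vec \<Rightarrow> complex mat" where
  "normal_sum_multi m r p \<theta> =
     mat_sum (\<Prod>l<m. r l) (\<lambda>\<xi>. mat_adjoint (p_multi m p \<xi>) * p_multi m p \<xi>) (Omega \<theta>)"

definition s_multi ::
    "nat \<Rightarrow> (nat \<Rightarrow> nat) \<Rightarrow> (nat \<Rightarrow> real \<Rightarrow> complex mat) \<Rightarrow> real vec \<Rightarrow> complex mat" where
  "s_multi m r p \<theta> =
     p_multi m p \<theta> * mat_inv (normal_sum_multi m r p \<theta>) * mat_adjoint (p_multi m p \<theta>)"

definition normal_sum_uni :: "(real \<Rightarrow> complex mat) \<Rightarrow> real \<Rightarrow> complex mat" where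
  "normal_sum_uni q t = mat_adjoint (q t) * q t + mat_adjoint (q (t + pi)) * q (t + pi)"

definition s_uni :: "(real \<Rightarrow> complex mat) \<Rightarrow> real \<Rightarrow> complex mat" where
  "s_uni q t = q t * mat_inv (normal_sum_uni q t) * mat_adjoint (q t)"

end

theory Submission
  imports Defs
begin

text \<open>By the mixed-product rule the summand at \<open>\<xi>\<close> is the Kronecker product of the matrices
  \<open>(p l (\<xi> $ l))\<^sup>H p l (\<xi> $ l)\<close>. Each coordinate of \<open>\<xi> \<in> Omega \<theta>\<close> independently takes one of
  two values, so by bilinearity the sum factors as the Kronecker product of the one-variable sums.
  A Kronecker product of nonempty square matrices is invertible only if all factors are, the
  inverse is taken factorwise, and the mixed-product rule gives the claim.\<close>

section \<open>Kronecker products\<close>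

lemma kronecker_carrier [intro]:
  "A \<in> carrier_mat a b \<Longrightarrow> B \<in> carrier_mat c d \<Longrightarrow> A \<otimes>\<^sub>K B \<in> carrier_mat (a * c) (b * d)"
  by (auto simp: kronecker_def)

lemma kronecker_index:
  assumes "A \<in> carrier_mat a b" "B \<in> carrier_mat c d" "i < a * c" "j < b * d"
  shows "(A \<otimes>\<^sub>K B) $$ (i, j) = A $$ (i div c, j div d) * B $$ (i mod c, j mod d)"
  using assms by (auto simp: kronecker_def)

text \<open>The hypothesis rules out \<open>c = 0\<close>, where \<open>i mod 0 = i\<close> would
  break the bound.\<close>

lemma mod_less_of_less_mult:
  fixes i :: nat
  assumes "i < a * c"
  shows "i mod c < c"
  using assms by (cases c) auto

text \<open>The map \<open>k\<close> to \<open>(k div d, k mod d)\<close> is a bijection from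
  \<open>{..<b * d}\<close> onto \<open>{..<b} \<times> {..<d}\<close>, with inverse
  \<open>(x, y)\<close> to \<open>x * d + y\<close>; distributivity then splits the double sum. This
  is the index arithmetic behind the mixed-product rule.\<close>

lemma sum_div_mod:
  fixes f g :: "nat \<Rightarrow> 'a :: comm_semiring_0"
  shows "(\<Sum>k<b * d. f (k div d) * g (k mod d)) = (\<Sum>k<b. f k) * (\<Sum>k<d. g k)"
proof -
  have "(\<Sum>k<b * d. f (k div d) * g (k mod d)) = (\<Sum>(x, y)\<in>{..<b} \<times> {..<d}. f x * g y)"
  proof (rule sum.reindex_bij_witness[where i = "\<lambda>(x, y). x * d + y" and j = "\<lambda>k. (k div d, k mod d)"])
    fix xy assume "xy \<in> {..<b} \<times> {..<d}"
    then obtain x y where xy: "xy = (x, y)" "x < b" "y < d" by auto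
    have "x * d + y < Suc x * d" using xy by simp
    also have "\<dots> \<le> b * d" using xy by (intro mult_right_mono) auto
    finally show "(case xy of (x, y) \<Rightarrow> x * d + y) \<in> {..<b * d}" using xy by simp
    show "((case xy of (x, y) \<Rightarrow> x * d + y) div d, (case xy of (x, y) \<Rightarrow> x * d + y) mod d) = xy"
      using xy by simp
  qed (auto simp: less_mult_imp_div_less mod_less_of_less_mult)
  then show ?thesis by (simp add: sum_product sum.cartesian_product)
qed

text \<open>The mixed-product rule. In the entry at \<open>(i, j)\<close>, each summand is a
  function of \<open>k div d\<close> times a function of \<open>k mod d\<close>, so the sum over
  \<open>k\<close> separates into an entry of \<open>A * C\<close> and an entry of
  \<open>B * D\<close>.\<close>

lemma kronecker_mult:
  assumes A: "A \<in> carrier_mat a b" and C: "C \<in> carrier_mat b e"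
    and B: "B \<in> carrier_mat c d" and D: "D \<in> carrier_mat d f"
  shows "(A \<otimes>\<^sub>K B) * (C \<otimes>\<^sub>K D) = (A * C) \<otimes>\<^sub>K (B * D)"
proof (rule eq_matI)
  note AB = kronecker_carrier[OF A B] and CD = kronecker_carrier[OF C D]
    and AC = mult_carrier_mat[OF A C] and BD = mult_carrier_mat[OF B D]
  note K = kronecker_carrier[OF AC BD]
  show "dim_row ((A \<otimes>\<^sub>K B) * (C \<otimes>\<^sub>K D)) = dim_row ((A * C) \<otimes>\<^sub>K (B * D))"
    "dim_col ((A \<otimes>\<^sub>K B) * (C \<otimes>\<^sub>K D)) = dim_col ((A * C) \<otimes>\<^sub>K (B * D))"
    using AB CD K by auto
  fix i j assume "i < dim_row ((A * C) \<otimes>\<^sub>K (B * D))" "j < dim_col ((A * C) \<otimes>\<^sub>K (B * D))"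
  with K have ij: "i < a * c" "j < e * f" by auto
  have dm: "i div c < a" "i mod c < c" "j div f < e" "j mod f < f"
    using ij by (auto simp: less_mult_imp_div_less mod_less_of_less_mult)
  have "((A \<otimes>\<^sub>K B) * (C \<otimes>\<^sub>K D)) $$ (i, j)
    = (\<Sum>k<b * d. (A \<otimes>\<^sub>K B) $$ (i, k) * (C \<otimes>\<^sub>K D) $$ (k, j))"
    using AB CD ij by (auto simp: scalar_prod_def atLeast0LessThan)
  also have "\<dots> = (\<Sum>k<b * d. (A $$ (i div c, k div d) * C $$ (k div d, j div f))
      * (B $$ (i mod c, k mod d) * D $$ (k mod d, j mod f)))"
    using A B C D ij by (intro sum.cong) (auto simp: kronecker_index)
  also have "\<dots> = (A * C) $$ (i div c, j div f) * (B * D) $$ (i mod c, j mod f)"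
    using A B C D dm by (subst sum_div_mod) (auto simp: scalar_prod_def atLeast0LessThan)
  also have "\<dots> = ((A * C) \<otimes>\<^sub>K (B * D)) $$ (i, j)"
    using kronecker_index[OF AC BD ij] by simp
  finally show "((A \<otimes>\<^sub>K B) * (C \<otimes>\<^sub>K D)) $$ (i, j) = ((A * C) \<otimes>\<^sub>K (B * D)) $$ (i, j)" .
qed

lemma kronecker_add_left:
  assumes "A \<in> carrier_mat a b" "B \<in> carrier_mat a b" "C \<in> carrier_mat c d"
  shows "(A + B) \<otimes>\<^sub>K C = A \<otimes>\<^sub>K C + B \<otimes>\<^sub>K C"
  using assms
  by (intro eq_matI)
    (auto simp: kronecker_def less_mult_imp_div_less mod_less_of_less_mult algebra_simps)

lemma kronecker_add_right:
  assumes "A \<in> carrier_mat a b" "C \<in> carrier_mat c d" "D \<in> carrier_mat c d"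
  shows "A \<otimes>\<^sub>K (C + D) = A \<otimes>\<^sub>K C + A \<otimes>\<^sub>K D"
  using assms
  by (intro eq_matI)
    (auto simp: kronecker_def less_mult_imp_div_less mod_less_of_less_mult distrib_left)

lemma kronecker_zero_left: "C \<in> carrier_mat c d \<Longrightarrow> 0\<^sub>m a b \<otimes>\<^sub>K C = 0\<^sub>m (a * c) (b * d)"
  by (intro eq_matI)
    (auto simp: kronecker_def less_mult_imp_div_less mod_less_of_less_mult)

lemma kronecker_zero_right: "C \<in> carrier_mat c d \<Longrightarrow> C \<otimes>\<^sub>K 0\<^sub>m a b = 0\<^sub>m (c * a) (d * b)"
  by (intro eq_matI)
    (auto simp: kronecker_def less_mult_imp_div_less mod_less_of_less_mult)

lemma kronecker_one: "1\<^sub>m a \<otimes>\<^sub>K 1\<^sub>m b = 1\<^sub>m (a * b)"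
proof (rule eq_matI)
  fix i j assume "i < dim_row (1\<^sub>m (a * b) :: complex mat)" "j < dim_col (1\<^sub>m (a * b) :: complex mat)"
  then have ij: "i < a * b" "j < a * b" by auto
  have "i div b = j div b \<and> i mod b = j mod b \<longleftrightarrow> i = j" by (metis div_mod_decomp)
  then show "(1\<^sub>m a \<otimes>\<^sub>K 1\<^sub>m b) $$ (i, j) = 1\<^sub>m (a * b) $$ (i, j)"
    using ij by (auto simp: kronecker_def less_mult_imp_div_less mod_less_of_less_mult)
qed (auto simp: kronecker_def)

section \<open>Conjugate transposes, and the absence of zero divisors\<close>

lemma mat_adjoint_index:
  "i < dim_col A \<Longrightarrow> j < dim_row A \<Longrightarrow> mat_adjoint A $$ (i, j) = conjugate (A $$ (j, i))"
  by (simp add: mat_adjoint_def mat_of_rows_def)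

lemma dim_mat_adjoint [simp]:
  "dim_row (mat_adjoint A) = dim_col A" "dim_col (mat_adjoint A) = dim_row A"
  by (auto simp: mat_adjoint_def)

lemma mat_adjoint_carrier [intro]: "A \<in> carrier_mat a b \<Longrightarrow> mat_adjoint A \<in> carrier_mat b a"
  by (intro carrier_matI) simp_all

lemma kronecker_adjoint: "mat_adjoint (A \<otimes>\<^sub>K B) = mat_adjoint A \<otimes>\<^sub>K mat_adjoint B"
proof (rule eq_matI)
  fix i j
  assume "i < dim_row (mat_adjoint A \<otimes>\<^sub>K mat_adjoint B)" "j < dim_col (mat_adjoint A \<otimes>\<^sub>K mat_adjoint B)"
  then have ij: "i < dim_col A * dim_col B" "j < dim_row A * dim_row B"
    by (simp_all add: kronecker_def)
  note less = less_mult_imp_div_less[OF ij(1)] less_mult_imp_div_less[OF ij(2)]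
    mod_less_of_less_mult[OF ij(1)] mod_less_of_less_mult[OF ij(2)]
  have "mat_adjoint (A \<otimes>\<^sub>K B) $$ (i, j) = conjugate ((A \<otimes>\<^sub>K B) $$ (j, i))"
    using ij by (intro mat_adjoint_index) (simp_all add: kronecker_def)
  then show "mat_adjoint (A \<otimes>\<^sub>K B) $$ (i, j) = (mat_adjoint A \<otimes>\<^sub>K mat_adjoint B) $$ (i, j)"
    using ij less by (simp add: kronecker_def mat_adjoint_index)
qed (simp_all add: kronecker_def)

text \<open>The product is made of the blocks \<open>A $$ (i, j)\<close> times \<open>B\<close>.
  Fixing one nonzero entry of \<open>B\<close>, its copy in each block shows that
  \<open>A $$ (i, j)\<close> vanishes.\<close>

lemma kronecker_eq_zeroD:
  assumes A: "A \<in> carrier_mat a b" and B: "B \<in> carrier_mat c d"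
    and 0: "A \<otimes>\<^sub>K B = 0\<^sub>m (a * c) (b * d)"
  shows "A = 0\<^sub>m a b \<or> B = 0\<^sub>m c d"
proof (rule disjCI)
  assume "B \<noteq> 0\<^sub>m c d"
  with B obtain k l where kl: "k < c" "l < d" "B $$ (k, l) \<noteq> 0" by (auto simp: mat_eq_iff)
  show "A = 0\<^sub>m a b"
  proof (rule eq_matI)
    fix i j assume "i < dim_row (0\<^sub>m a b :: complex mat)" "j < dim_col (0\<^sub>m a b :: complex mat)"
    then have ij: "i < a" "j < b" by auto
    have "i * c + k < Suc i * c" "j * d + l < Suc j * d" using kl by auto
    moreover have "Suc i * c \<le> a * c" "Suc j * d \<le> b * d"
      using ij by (intro mult_right_mono; simp)+
    ultimately have lt: "i * c + k < a * c" "j * d + l < b * d" by linarith+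
    have "A $$ (i, j) * B $$ (k, l) = (A \<otimes>\<^sub>K B) $$ (i * c + k, j * d + l)"
      using kl by (subst kronecker_index[OF A B lt]) auto
    then show "A $$ (i, j) = 0\<^sub>m a b $$ (i, j)" using kl ij lt 0 by simp
  qed (use A in auto)
qed

section \<open>Kronecker products of finitely many factors\<close>

lemma kronecker_prod_carrier:
  assumes "\<And>l. l < m \<Longrightarrow> A l \<in> carrier_mat (r l) (s l)"
  shows "kronecker_prod A m \<in> carrier_mat (\<Prod>l<m. r l) (\<Prod>l<m. s l)"
  using assms by (induction m) auto

lemma kronecker_prod_cong:
  "(\<And>l. l < m \<Longrightarrow> A l = B l) \<Longrightarrow> kronecker_prod A m = kronecker_prod B m"
  by (induction m) auto

lemma kronecker_prod_mult:
  assumes "\<And>l. l < m \<Longrightarrow> A l \<in> carrier_mat (r l) (s l)" "\<And>l. l < m \<Longrightarrow> B l \<in> carrier_mat (s l) (t l)"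
  shows "kronecker_prod A m * kronecker_prod B m = kronecker_prod (\<lambda>l. A l * B l) m"
  using assms
proof (induction m)
  case (Suc m)
  have KA: "kronecker_prod A m \<in> carrier_mat (\<Prod>l<m. r l) (\<Prod>l<m. s l)"
    by (rule kronecker_prod_carrier) (simp add: Suc.prems(1))
  have KB: "kronecker_prod B m \<in> carrier_mat (\<Prod>l<m. s l) (\<Prod>l<m. t l)"
    by (rule kronecker_prod_carrier) (simp add: Suc.prems(2))
  have "kronecker_prod A (Suc m) * kronecker_prod B (Suc m)
    = (kronecker_prod A m * kronecker_prod B m) \<otimes>\<^sub>K (A m * B m)"
    unfolding kronecker_prod.simps
    by (rule kronecker_mult[OF KA KB Suc.prems(1)[OF lessI] Suc.prems(2)[OF lessI]])
  then show ?case using Suc by simp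
qed simp

lemma mat_adjoint_one: "mat_adjoint (1\<^sub>m n :: complex mat) = 1\<^sub>m n"
  by (intro eq_matI) (auto simp: mat_adjoint_index)

lemma kronecker_prod_adjoint:
  "mat_adjoint (kronecker_prod A m) = kronecker_prod (\<lambda>l. mat_adjoint (A l)) m"
  by (induction m) (simp_all add: kronecker_adjoint mat_adjoint_one)

lemma kronecker_prod_one: "kronecker_prod (\<lambda>l. 1\<^sub>m (r l)) m = 1\<^sub>m (\<Prod>l<m. r l)"
  by (induction m) (simp_all add: kronecker_one)


section \<open>Sums of Kronecker products\<close>

lemma mat_sum_carrier:
  assumes "\<And>x. x \<in> X \<Longrightarrow> f x \<in> carrier_mat n n"
  shows "mat_sum n f X \<in> carrier_mat n n"
proof -
  interpret abelian_group "module_mat TYPE(complex) n n" by (rule abelian_group_mat)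
  show ?thesis using finsum_closed[of f X] assms by (auto simp: module_mat_simps Pi_def)
qed

text \<open>Additivity in the left argument, extended by induction to finite sums. It pulls the last
  factor out of a sum over subsets in the expansion below.\<close>

lemma mat_sum_kronecker_left:
  assumes "finite X" and C: "C \<in> carrier_mat k k" and "\<And>x. x \<in> X \<Longrightarrow> f x \<in> carrier_mat n n"
  shows "mat_sum (n * k) (\<lambda>x. f x \<otimes>\<^sub>K C) X = mat_sum n f X \<otimes>\<^sub>K C"
proof -
  interpret N: abelian_group "module_mat TYPE(complex) n n" by (rule abelian_group_mat)
  interpret NK: abelian_group "module_mat TYPE(complex) (n * k) (n * k)" by (rule abelian_group_mat)
  show ?thesis using assms(1,3)
  proof (induction X rule: finite_induct)
    case empty
    then show ?case using kronecker_zero_left[OF C, of n n] by (simp add: module_mat_simps)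
  next
    case (insert x X)
    then have "mat_sum (n * k) (\<lambda>x. f x \<otimes>\<^sub>K C) (insert x X)
      = f x \<otimes>\<^sub>K C + mat_sum (n * k) (\<lambda>x. f x \<otimes>\<^sub>K C) X"
      using C by (subst NK.finsum_insert) (auto simp: module_mat_simps Pi_def)
    also have "\<dots> = (f x + mat_sum n f X) \<otimes>\<^sub>K C"
      using insert C by (simp add: kronecker_add_left[OF _ mat_sum_carrier])
    also have "f x + mat_sum n f X = mat_sum n f (insert x X)"
      using insert by (subst N.finsum_insert) (auto simp: module_mat_simps Pi_def)
    finally show ?case .
  qed
qed

text \<open>Multilinear expansion: choosing one summand from each factor gives one term per subset,
  where \<open>S\<close> marks the factors contributing \<open>B l\<close>. The induction splits the
  subsets of \<open>{..<Suc m}\<close> by whether they contain \<open>m\<close>; the two halves end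
  in the factor \<open>A m\<close> or \<open>B m\<close>, and additivity in the right argument
  recombines them.\<close>

lemma kronecker_prod_add:
  assumes "\<And>l. l < m \<Longrightarrow> A l \<in> carrier_mat (r l) (r l)" "\<And>l. l < m \<Longrightarrow> B l \<in> carrier_mat (r l) (r l)"
  shows "kronecker_prod (\<lambda>l. A l + B l) m
    = mat_sum (\<Prod>l<m. r l) (\<lambda>S. kronecker_prod (\<lambda>l. if l \<in> S then B l else A l) m) (Pow {..<m})"
  using assms
proof (induction m)
  case 0
  interpret N: abelian_group "module_mat TYPE(complex) 1 1" by (rule abelian_group_mat)
  \<comment> \<open>With no factors the only subset is the empty one, and its term is the empty
    product.\<close>
  have "mat_sum 1 (\<lambda>_. 1\<^sub>m 1) {{} :: nat set} = 1\<^sub>m 1"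
    using N.finsum_insert[of "{}" "{}" "\<lambda>_ :: nat set. 1\<^sub>m 1"]
      N.finsum_empty[of "\<lambda>_ :: nat set. 1\<^sub>m 1"]
    by (simp add: module_mat_simps)
  then show ?case by simp
next
  case (Suc m)
  define n where "n = (\<Prod>l<m. r l)"
  define f where "f m S = kronecker_prod (\<lambda>l. if l \<in> S then B l else A l) m" for m S
  have f: "f m S \<in> carrier_mat n n" for S
    unfolding f_def n_def by (rule kronecker_prod_carrier) (use Suc.prems in auto)
  have Am: "A m \<in> carrier_mat (r m) (r m)" and Bm: "B m \<in> carrier_mat (r m) (r m)"
    using Suc.prems by auto
  have S0: "f (Suc m) S = f m S \<otimes>\<^sub>K A m" if "S \<subseteq> {..<m}" for S
    using that by (auto simp: f_def)
  have S1: "f (Suc m) (insert m S) = f m S \<otimes>\<^sub>K B m" if "S \<subseteq> {..<m}" for S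
    using that by (auto simp: f_def intro!: arg_cong2[where f = kronecker] kronecker_prod_cong)
  interpret NK: abelian_group "module_mat TYPE(complex) (n * r m) (n * r m)" by (rule abelian_group_mat)
  have inj: "inj_on (insert m) (Pow {..<m})"
    by (rule inj_onI) (metis PowD insert_ident lessThan_iff less_irrefl subsetD)
  have fK: "f m S \<otimes>\<^sub>K A m \<in> carrier_mat (n * r m) (n * r m)"
    "f m S \<otimes>\<^sub>K B m \<in> carrier_mat (n * r m) (n * r m)" for S
    using f Am Bm by auto
  have "mat_sum (n * r m) (f (Suc m)) (Pow {..<Suc m})
    = mat_sum (n * r m) (f (Suc m)) (Pow {..<m} \<union> insert m ` Pow {..<m})"
    by (simp add: lessThan_Suc Pow_insert)
  also have "\<dots> = mat_sum (n * r m) (f (Suc m)) (Pow {..<m})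
      + mat_sum (n * r m) (f (Suc m)) (insert m ` Pow {..<m})"
    by (subst NK.finsum_Un_disjoint) (auto simp: module_mat_simps Pi_def S0 S1 fK)
  also have "mat_sum (n * r m) (f (Suc m)) (insert m ` Pow {..<m})
      = mat_sum (n * r m) (\<lambda>S. f (Suc m) (insert m S)) (Pow {..<m})"
    by (rule NK.finsum_reindex[OF _ inj]) (auto simp: module_mat_simps S1 fK)
  also have "\<dots> = mat_sum (n * r m) (\<lambda>S. f m S \<otimes>\<^sub>K B m) (Pow {..<m})"
    by (rule NK.finsum_cong') (auto simp: module_mat_simps S1 fK)
  also have "\<dots> = mat_sum n (f m) (Pow {..<m}) \<otimes>\<^sub>K B m"
    by (rule mat_sum_kronecker_left) (use f Bm in auto)
  also have "mat_sum (n * r m) (f (Suc m)) (Pow {..<m})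
      = mat_sum (n * r m) (\<lambda>S. f m S \<otimes>\<^sub>K A m) (Pow {..<m})"
    by (rule NK.finsum_cong') (auto simp: module_mat_simps S0 fK)
  also have "\<dots> = mat_sum n (f m) (Pow {..<m}) \<otimes>\<^sub>K A m"
    by (rule mat_sum_kronecker_left) (use f Am in auto)
  also have "mat_sum n (f m) (Pow {..<m}) \<otimes>\<^sub>K A m + mat_sum n (f m) (Pow {..<m}) \<otimes>\<^sub>K B m
      = mat_sum n (f m) (Pow {..<m}) \<otimes>\<^sub>K (A m + B m)"
    by (rule kronecker_add_right[symmetric, OF mat_sum_carrier Am Bm]) (rule f)
  also have "mat_sum n (f m) (Pow {..<m}) = kronecker_prod (\<lambda>l. A l + B l) m"
    using Suc.IH Suc.prems by (simp add: f_def[abs_def] n_def)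
  finally show ?case by (simp add: f_def[abs_def] n_def mult.commute)
qed


section \<open>Invertibility\<close>

lemma invertible_mat_iff_det:
  fixes X :: "'a :: field mat"
  assumes X: "X \<in> carrier_mat n n"
  shows "invertible_mat X \<longleftrightarrow> det X \<noteq> 0"
proof
  assume "invertible_mat X"
  then obtain B where B: "X * B = 1\<^sub>m n" "B * X = 1\<^sub>m (dim_row B)"
    using X by (auto simp: invertible_mat_def inverts_mat_def)
  \<comment> \<open>The definition of \<open>invertible_mat\<close> does not fix the shape of
    \<open>B\<close>, so its dimensions are read off from the two identities.\<close>
  have "dim_col B = n" using arg_cong[OF B(1), of dim_col] by simp
  moreover have "dim_row B = n" using arg_cong[OF B(2), of dim_col] X by simp
  ultimately have "B \<in> carrier_mat n n" by auto
  with det_mult[OF X this] B show "det X \<noteq> 0" by auto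
next
  assume "det X \<noteq> 0"
  from det_non_zero_imp_unit[OF X this, of "()"]
  show "invertible_mat X"
    using X by (auto simp: Units_def ring_mat_def invertible_mat_def inverts_mat_def)
qed

text \<open>A nonzero determinant makes \<open>X\<close> a unit of the matrix ring, so
  \<open>mat_inverse X\<close> is a \<open>Some\<close> and the \<open>the\<close> in
  \<open>mat_inv\<close> is harmless.\<close>

lemma mat_inv_inverse:
  assumes X: "X \<in> carrier_mat n n" and inv: "invertible_mat X"
  shows "mat_inv X \<in> carrier_mat n n" "X * mat_inv X = 1\<^sub>m n" "mat_inv X * X = 1\<^sub>m n"
proof -
  have "X \<in> Units (ring_mat TYPE(complex) n ())"
    using det_non_zero_imp_unit[OF X] inv unfolding invertible_mat_iff_det[OF X] .
  with mat_inverse(1)[OF X, of "()"] obtain Y where Y: "mat_inverse X = Some Y" by blast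
  from mat_inverse(2)[OF X Y] Y
  show "mat_inv X \<in> carrier_mat n n" "X * mat_inv X = 1\<^sub>m n" "mat_inv X * X = 1\<^sub>m n"
    by (auto simp: mat_inv_def)
qed

text \<open>For square matrices over a field a right inverse is two-sided, so a single product
  suffices to identify \<open>mat_inv X\<close>.\<close>

lemma mat_inv_unique:
  assumes X: "X \<in> carrier_mat n n" and Y: "Y \<in> carrier_mat n n" and XY: "X * Y = 1\<^sub>m n"
  shows "mat_inv X = Y"
proof -
  have "X * Y = 1\<^sub>m (dim_row X)" "Y * X = 1\<^sub>m (dim_row Y)"
    using mat_mult_left_right_inverse[OF X Y XY] XY X Y by auto
  then have "invertible_mat X" using X unfolding invertible_mat_def inverts_mat_def by auto
  note I = mat_inv_inverse[OF X this]
  have "mat_inv X = mat_inv X * (X * Y)" using I XY by simp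
  also have "\<dots> = mat_inv X * X * Y" by (rule assoc_mult_mat[OF I(1) X Y, symmetric])
  finally show ?thesis using I Y by simp
qed

text \<open>A trivial-kernel criterion, phrased with matrices \<open>C\<close> instead of vectors so
  that the mixed-product rule applies to it directly.\<close>

lemma invertible_mat_iff_mult_zero:
  fixes X :: "'a :: field mat"
  assumes X: "X \<in> carrier_mat n n"
  shows "invertible_mat X \<longleftrightarrow> (\<forall>C \<in> carrier_mat n n. X * C = 0\<^sub>m n n \<longrightarrow> C = 0\<^sub>m n n)"
proof
  assume "invertible_mat X"
  from det_non_zero_imp_unit[OF X, of "()"] this
  obtain Y where Y: "Y \<in> carrier_mat n n" "Y * X = 1\<^sub>m n"
    using invertible_mat_iff_det[OF X] by (auto simp: Units_def ring_mat_def)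
  show "\<forall>C \<in> carrier_mat n n. X * C = 0\<^sub>m n n \<longrightarrow> C = 0\<^sub>m n n"
  proof (intro ballI impI)
    fix C assume C: "C \<in> carrier_mat n n" "X * C = 0\<^sub>m n n"
    have "C = Y * X * C" using Y C by simp
    also have "\<dots> = Y * (X * C)" by (rule assoc_mult_mat[OF Y(1) X C(1)])
    finally show "C = 0\<^sub>m n n" using C Y by simp
  qed
next
  assume *: "\<forall>C \<in> carrier_mat n n. X * C = 0\<^sub>m n n \<longrightarrow> C = 0\<^sub>m n n"
  show "invertible_mat X"
  proof (rule ccontr)
    assume "\<not> invertible_mat X"
    then obtain v where v: "v \<in> carrier_vec n" "v \<noteq> 0\<^sub>v n" "X *\<^sub>v v = 0\<^sub>v n"
      using invertible_mat_iff_det[OF X] det_0_iff_vec_prod_zero[OF X] by blast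
    \<comment> \<open>Every column is the kernel vector \<open>v\<close>, which turns it into a
      square matrix annihilated by \<open>X\<close>.\<close>
    define C where "C = mat n n (\<lambda>(i, j). v $ i)"
    have C: "C \<in> carrier_mat n n" by (simp add: C_def)
    have "col C j = v" if "j < n" for j using that v by (auto simp: C_def)
    then have "X * C = 0\<^sub>m n n"
      using X C v by (intro eq_matI) (auto simp: index_mult_mat_vec[symmetric] simp del: index_mult_mat_vec)
    with * C have "C = 0\<^sub>m n n" by blast
    \<comment> \<open>The index \<open>i\<close> also serves as a column index, because all columns
      of \<open>C\<close> equal \<open>v\<close>.\<close>
    moreover obtain i where i: "i < n" "v $ i \<noteq> 0" using v by (metis carrier_vecD eq_vecI index_zero_vec)
    ultimately have "C $$ (i, i) = 0" by simp
    then show False using i by (simp add: C_def)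
  qed
qed

text \<open>A singular matrix has a nonzero kernel vector, at which the quadratic form would be zero
  instead of positive.\<close>

lemma hermitian_pos_def_invertible:
  assumes "hermitian_pos_def X"
  shows "invertible_mat X"
proof -
  define n where "n = dim_row X"
  have X: "X \<in> carrier_mat n n" using assms by (auto simp: hermitian_pos_def_def n_def)
  have "det X \<noteq> 0"
  proof
    assume "det X = 0"
    then obtain v where v: "v \<in> carrier_vec n" "v \<noteq> 0\<^sub>v n" "X *\<^sub>v v = 0\<^sub>v n"
      using det_0_iff_vec_prod_zero[OF X] by blast
    then have "0 < (X *\<^sub>v v) \<bullet>c v" using assms unfolding hermitian_pos_def_def n_def by blast
    also have "(X *\<^sub>v v) \<bullet>c v = 0" using v by (simp add: carrier_vec_conjugate)
    finally show False by simp
  qed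
  then show ?thesis using invertible_mat_iff_det[OF X] by simp
qed

text \<open>If \<open>A * C = 0\<close>, then \<open>A \<otimes>\<^sub>K B\<close> annihilates
  \<open>C \<otimes>\<^sub>K 1\<^sub>m b\<close>, which is therefore zero; as the identity is
  nonzero for \<open>b > 0\<close>, \<open>C\<close> is zero. The argument for \<open>B\<close> is
  symmetric. Positivity matters: an empty factor makes the whole product empty, hence invertible,
  whatever the other factor is.\<close>

lemma invertible_kroneckerD:
  assumes A: "A \<in> carrier_mat a a" and B: "B \<in> carrier_mat b b" and pos: "a > 0" "b > 0"
    and inv: "invertible_mat (A \<otimes>\<^sub>K B)"
  shows "invertible_mat A" "invertible_mat B"
proof -
  have one: "1\<^sub>m k \<noteq> (0\<^sub>m k k :: complex mat)" if "k > 0" for k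
    using that by (auto simp: mat_eq_iff)
  note zero = inv[unfolded invertible_mat_iff_mult_zero[OF kronecker_carrier[OF A B]], rule_format]
  have "C = 0\<^sub>m a a" if C: "C \<in> carrier_mat a a" "A * C = 0\<^sub>m a a" for C
  proof -
    have "(A \<otimes>\<^sub>K B) * (C \<otimes>\<^sub>K 1\<^sub>m b) = 0\<^sub>m (a * b) (a * b)"
      by (subst kronecker_mult[OF A C(1) B one_carrier_mat]) (use B C kronecker_zero_left in auto)
    with zero kronecker_carrier[OF C(1) one_carrier_mat]
    have "C \<otimes>\<^sub>K 1\<^sub>m b = 0\<^sub>m (a * b) (a * b)" by blast
    then show ?thesis using kronecker_eq_zeroD[OF C(1) one_carrier_mat] one pos by blast
  qed
  then show "invertible_mat A" using invertible_mat_iff_mult_zero[OF A] by blast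
  have "C = 0\<^sub>m b b" if C: "C \<in> carrier_mat b b" "B * C = 0\<^sub>m b b" for C
  proof -
    have "(A \<otimes>\<^sub>K B) * (1\<^sub>m a \<otimes>\<^sub>K C) = 0\<^sub>m (a * b) (a * b)"
      by (subst kronecker_mult[OF A one_carrier_mat B C(1)]) (use A C kronecker_zero_right in auto)
    with zero kronecker_carrier[OF one_carrier_mat C(1)]
    have "1\<^sub>m a \<otimes>\<^sub>K C = 0\<^sub>m (a * b) (a * b)" by blast
    then show ?thesis using kronecker_eq_zeroD[OF one_carrier_mat C(1)] one pos by blast
  qed
  then show "invertible_mat B" using invertible_mat_iff_mult_zero[OF B] by blast
qed

lemma invertible_kronecker_prodD:
  assumes "\<And>l. l < m \<Longrightarrow> A l \<in> carrier_mat (r l) (r l)" "\<And>l. l < m \<Longrightarrow> r l > 0"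
    and "invertible_mat (kronecker_prod A m)" and "l < m"
  shows "invertible_mat (A l)"
  using assms
proof (induction m)
  case (Suc m)
  have K: "kronecker_prod A m \<in> carrier_mat (\<Prod>l<m. r l) (\<Prod>l<m. r l)"
    by (rule kronecker_prod_carrier) (use Suc.prems in auto)
  have pos: "(\<Prod>l<m. r l) > 0" using Suc.prems by (intro prod_pos) auto
  have "invertible_mat (kronecker_prod A m)" "invertible_mat (A m)"
    using invertible_kroneckerD[OF K Suc.prems(1)[of m] pos Suc.prems(2)[of m]] Suc.prems(3)
    by simp_all
  then show ?case using Suc by (cases "l = m") auto
qed simp

text \<open>Multiplying by the factorwise inverses gives a Kronecker product of identities, which is
  an identity; uniqueness of the inverse finishes.\<close>

lemma mat_inv_kronecker_prod:
  assumes A: "\<And>l. l < m \<Longrightarrow> A l \<in> carrier_mat (r l) (r l)" and "\<And>l. l < m \<Longrightarrow> invertible_mat (A l)"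
  shows "mat_inv (kronecker_prod A m) = kronecker_prod (\<lambda>l. mat_inv (A l)) m"
proof (rule mat_inv_unique)
  have I: "mat_inv (A l) \<in> carrier_mat (r l) (r l)" "A l * mat_inv (A l) = 1\<^sub>m (r l)" if "l < m" for l
    using mat_inv_inverse assms that by auto
  show "kronecker_prod A m \<in> carrier_mat (\<Prod>l<m. r l) (\<Prod>l<m. r l)"
    "kronecker_prod (\<lambda>l. mat_inv (A l)) m \<in> carrier_mat (\<Prod>l<m. r l) (\<Prod>l<m. r l)"
    by (rule kronecker_prod_carrier, use A I in auto)+
  have "kronecker_prod A m * kronecker_prod (\<lambda>l. mat_inv (A l)) m
    = kronecker_prod (\<lambda>l. A l * mat_inv (A l)) m"
    by (rule kronecker_prod_mult[OF A I(1)])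
  also have "\<dots> = kronecker_prod (\<lambda>l. 1\<^sub>m (r l)) m" by (rule kronecker_prod_cong) (rule I)
  finally show "kronecker_prod A m * kronecker_prod (\<lambda>l. mat_inv (A l)) m = 1\<^sub>m (\<Prod>l<m. r l)"
    by (simp add: kronecker_prod_one)
qed


section \<open>Factorization of the normal sum\<close>

text \<open>A 0-1 vector \<open>\<eta>\<close> is encoded by its support, which turns the shifts
  into the index set of \<open>kronecker_prod_add\<close>.\<close>

lemma Omega_eq_image:
  assumes "\<theta> \<in> carrier_vec m"
  shows "Omega \<theta> = (\<lambda>S. vec m (\<lambda>l. if l \<in> S then \<theta> $ l + pi else \<theta> $ l)) ` Pow {..<m}"
    (is "_ = ?g ` _")
proof (intro equalityI subsetI)
  fix \<xi> assume "\<xi> \<in> Omega \<theta>"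
  then obtain \<eta> where \<eta>: "\<xi> = \<theta> + pi \<cdot>\<^sub>v \<eta>" "\<eta> \<in> carrier_vec m" "\<forall>l<m. \<eta> $ l \<in> {0, 1}"
    using assms by (auto simp: Omega_def)
  have "\<xi> = ?g {l. l < m \<and> \<eta> $ l = 1}" using \<eta> assms by (intro eq_vecI) auto
  then show "\<xi> \<in> ?g ` Pow {..<m}" by (rule image_eqI) auto
next
  fix \<xi> assume "\<xi> \<in> ?g ` Pow {..<m}"
  then obtain S where S: "\<xi> = ?g S" by auto
  define \<eta> :: "real vec" where "\<eta> = vec m (\<lambda>l. if l \<in> S then 1 else 0)"
  have "\<xi> = \<theta> + pi \<cdot>\<^sub>v \<eta>" using S assms by (intro eq_vecI) (auto simp: \<eta>_def)
  then show "\<xi> \<in> Omega \<theta>" using assms by (auto simp: Omega_def \<eta>_def intro!: exI[of _ \<eta>])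
qed

lemma matrix_trig_poly_carrier:
  assumes "matrix_trig_poly r p"
  shows "p t \<in> carrier_mat r r"
  using assms by (auto simp: matrix_trig_poly_def intro!: mat_sum_carrier)

text \<open>The point of \<open>Omega \<theta>\<close> belonging to \<open>S\<close> contributes
  exactly the term for \<open>S\<close> in the expansion of the Kronecker product of the two-term
  sums.\<close>

lemma normal_sum_multi_eq_kronecker_prod:
  assumes p: "\<And>l t. l < m \<Longrightarrow> p l t \<in> carrier_mat (r l) (r l)" and \<theta>: "\<theta> \<in> carrier_vec m"
  shows "normal_sum_multi m r p \<theta> = kronecker_prod (\<lambda>l. normal_sum_uni (p l) (\<theta> $ l)) m"
proof -
  define n where "n = (\<Prod>l<m. r l)"
  define g where "g S = vec m (\<lambda>l. if l \<in> S then \<theta> $ l + pi else \<theta> $ l)" for S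
  define N where "N l t = mat_adjoint (p l t) * p l t" for l t
  have N: "N l t \<in> carrier_mat (r l) (r l)" if "l < m" for l t
    using p[OF that, of t] by (auto simp: N_def)
  \<comment> \<open>Since \<open>pi\<close> is nonzero, distinct subsets give distinct points, so
    the sum over the set \<open>Omega \<theta>\<close> has one term per subset.\<close>
  have inj: "inj_on g (Pow {..<m})"
  proof (rule inj_onI)
    fix S T assume ST: "S \<in> Pow {..<m}" "T \<in> Pow {..<m}" "g S = g T"
    have "l \<in> S \<longleftrightarrow> l \<in> T" if "l < m" for l
      using arg_cong[OF ST(3), of "\<lambda>v. v $ l"] that by (auto simp: g_def split: if_splits)
    with ST show "S = T" by auto
  qed
  have summand: "mat_adjoint (p_multi m p (g S)) * p_multi m p (g S)
    = kronecker_prod (\<lambda>l. if l \<in> S then N l (\<theta> $ l + pi) else N l (\<theta> $ l)) m" for S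
  proof -
    have "mat_adjoint (p_multi m p (g S)) * p_multi m p (g S) = kronecker_prod (\<lambda>l. N l (g S $ l)) m"
      unfolding p_multi_def kronecker_prod_adjoint N_def
      by (rule kronecker_prod_mult) (use p in auto)
    also have "\<dots> = kronecker_prod (\<lambda>l. if l \<in> S then N l (\<theta> $ l + pi) else N l (\<theta> $ l)) m"
      by (rule kronecker_prod_cong) (simp add: g_def)
    finally show ?thesis .
  qed
  have K: "kronecker_prod (\<lambda>l. if l \<in> S then N l (\<theta> $ l + pi) else N l (\<theta> $ l)) m \<in> carrier_mat n n" for S
    unfolding n_def by (rule kronecker_prod_carrier) (use N in auto)
  interpret abelian_group "module_mat TYPE(complex) n n" by (rule abelian_group_mat)
  have "normal_sum_multi m r p \<theta>
    = mat_sum n (\<lambda>\<xi>. mat_adjoint (p_multi m p \<xi>) * p_multi m p \<xi>) (g ` Pow {..<m})"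
    using Omega_eq_image[OF \<theta>] by (simp add: normal_sum_multi_def n_def g_def)
  also have "\<dots> = mat_sum n (\<lambda>S. mat_adjoint (p_multi m p (g S)) * p_multi m p (g S)) (Pow {..<m})"
    by (rule finsum_reindex[OF _ inj]) (auto simp: module_mat_simps summand K)
  \<comment> \<open>The multilinear expansion is read from right to left.\<close>
  also have "\<dots> = kronecker_prod (\<lambda>l. N l (\<theta> $ l) + N l (\<theta> $ l + pi)) m"
    unfolding summand n_def by (rule kronecker_prod_add[symmetric]) (use N in auto)
  finally show ?thesis by (simp add: N_def normal_sum_uni_def)
qed

text \<open>As \<open>mat_inv\<close> is total, well-definedness is expressed by invertibility, both
  for the full sum and for each one-variable sum. The condition \<open>r l \<ge> 1\<close> excludes
  empty matrices: one empty factor would make the positivity hypothesis vacuous and leave the other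
  one-variable sums unconstrained.\<close>

theorem lemma6p3:
  fixes m :: nat and r :: "nat \<Rightarrow> nat" and p :: "nat \<Rightarrow> real \<Rightarrow> complex mat"
  assumes "m \<ge> 1"
    and "\<And>l. l < m \<Longrightarrow> r l \<ge> 1"
    and "\<And>l. l < m \<Longrightarrow> matrix_trig_poly (r l) (p l)"
    and "\<And>\<theta>. \<theta> \<in> theta_box m \<Longrightarrow> hermitian_pos_def (normal_sum_multi m r p \<theta>)"
  shows "(\<forall>\<theta> \<in> theta_box m. invertible_mat (normal_sum_multi m r p \<theta>)) \<and>
    (\<forall>\<theta> \<in> theta_box m.
       (\<forall>l < m. invertible_mat (normal_sum_uni (p l) (\<theta> $ l))) \<and>
       s_multi m r p \<theta> = kronecker_prod (\<lambda>l. s_uni (p l) (\<theta> $ l)) m)"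
proof -
  have p: "p l t \<in> carrier_mat (r l) (r l)" if "l < m" for l t
    using assms(3)[OF that] by (rule matrix_trig_poly_carrier)
  have pH: "mat_adjoint (p l t) \<in> carrier_mat (r l) (r l)" if "l < m" for l t
    using p[OF that] by (rule mat_adjoint_carrier)
  have inv: "invertible_mat (normal_sum_multi m r p \<theta>)" if "\<theta> \<in> theta_box m" for \<theta>
    using assms(4)[OF that] by (rule hermitian_pos_def_invertible)
  moreover have "(\<forall>l < m. invertible_mat (normal_sum_uni (p l) (\<theta> $ l))) \<and>
       s_multi m r p \<theta> = kronecker_prod (\<lambda>l. s_uni (p l) (\<theta> $ l)) m"
    if \<theta>: "\<theta> \<in> theta_box m" for \<theta>
  proof -
    define N where "N l = normal_sum_uni (p l) (\<theta> $ l)" for l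
    have N: "N l \<in> carrier_mat (r l) (r l)" if "l < m" for l
      unfolding N_def normal_sum_uni_def using p[OF that] pH[OF that]
      by (intro add_carrier_mat mult_carrier_mat)
    have KN: "normal_sum_multi m r p \<theta> = kronecker_prod N m"
      unfolding N_def using \<theta> by (intro normal_sum_multi_eq_kronecker_prod p) (auto simp: theta_box_def)
    \<comment> \<open>Positivity is assumed only for the full sum; its invertibility descends to the
      factors because all of them are nonempty.\<close>
    have invN: "invertible_mat (N l)" if "l < m" for l
    proof (rule invertible_kronecker_prodD[OF N _ _ that])
      show "r l > 0" if "l < m" for l using assms(2)[OF that] by simp
    qed (use inv[OF \<theta>] KN in auto)
    have NI: "mat_inv (N l) \<in> carrier_mat (r l) (r l)" if "l < m" for l
      using mat_inv_inverse(1) N invN that by blast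
    have KI: "mat_inv (kronecker_prod N m) = kronecker_prod (\<lambda>l. mat_inv (N l)) m"
      using N invN by (rule mat_inv_kronecker_prod)
    \<comment> \<open>All three matrices are now Kronecker products with matching factor sizes, so
      two uses of the mixed-product rule merge them factor by factor.\<close>
    have "s_multi m r p \<theta> = kronecker_prod (\<lambda>l. p l (\<theta> $ l)) m * kronecker_prod (\<lambda>l. mat_inv (N l)) m
        * kronecker_prod (\<lambda>l. mat_adjoint (p l (\<theta> $ l))) m"
      unfolding s_multi_def p_multi_def KN KI kronecker_prod_adjoint ..
    also have "kronecker_prod (\<lambda>l. p l (\<theta> $ l)) m * kronecker_prod (\<lambda>l. mat_inv (N l)) m
        = kronecker_prod (\<lambda>l. p l (\<theta> $ l) * mat_inv (N l)) m"
      by (rule kronecker_prod_mult[OF p NI])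
    also have "\<dots> * kronecker_prod (\<lambda>l. mat_adjoint (p l (\<theta> $ l))) m
        = kronecker_prod (\<lambda>l. p l (\<theta> $ l) * mat_inv (N l) * mat_adjoint (p l (\<theta> $ l))) m"
      by (rule kronecker_prod_mult[OF mult_carrier_mat[OF p NI] pH])
    finally show ?thesis using invN by (simp add: s_uni_def N_def)
  qed
  ultimately show ?thesis by blast
qed

end
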